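(* Let $\mathbb F$ be an algebraically closed field with $\operatorname{char}\mathbb F\neq 2$. Consider the following list of 3-dimensional nilpotent associative $\mathbb F$-algebras: $\mathfrak a_0$, $\mathfrak c_1$, $\mathfrak c_3$, $\mathfrak l_1$, $\mathfrak c_5$ and $\mathfrak a(\delta)$ for $\delta\in\mathbb F$ (defined in the context). For two distinct members $\mathfrak g,\mathfrak h$ of this list, $\mathfrak g$ degenerates to $\mathfrak h$ if and only if $(\mathfrak g,\mathfrak h)$ is one of the following pairs: (1) $(\mathfrak c_5,\mathfrak c_3)$, $(\mathfrak c_5,\mathfrak c_1)$, $(\mathfrak c_5,\mathfrak a_0)$; (2) $(\mathfrak c_3,\mathfrak c_1)$, $(\mathfrak c_3,\mathfrak a_0)$; (3) $(\mathfrak a(\delta),\mathfrak c_1)$, $(\mathfrak a(\delta),\mathfrak a_0)$ for any $\delta\in\mathbb F$; (4) $(\mathfrak a(\delta),\mathfrak l_1)$ with $\delta=(4\cdot 1_{\mathbb F})^{-1}$; (5) $(\mathfrak c_1,\mathfrak a_0)$, $(\mathfrak l_1,\mathfrak a_0)$.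
   Context: Let $V$ be a 3-dimensional $\mathbb F$-vector space with a fixed ordered basis $(e_1,e_2,e_3)$. An algebra structure on $V$ is an $\mathbb F$-algebra with underlying space $V$, given by an arbitrary $\mathbb F$-bilinear product $V\times V\to V$. It is associative if $(uv)w=u(vw)$ for all $u,v,w$, and nilpotent if for some $r\ge 1$ all left-normed products $(\cdots((w_1w_2)w_3)\cdots)w_{r+1}$ vanish. The structure vector of an algebra structure $\mathfrak g$ relative to an ordered basis $(u_1,u_2,u_3)$ of $V$ is $(\gamma_{ijk})_{1\le i,j,k\le 3}\in\mathbb F^{27}$, where $u_iu_j=\sum_k\gamma_{ijk}u_k$. Let $\Lambda=\mathbb F^{27}$ with the Zariski topology, and let $\Theta(\mathfrak g)\in\Lambda$ be the structure vector of $\mathfrak g$ relative to $(e_1,e_2,e_3)$; $\Theta$ is a bijection from algebra structures on $V$ to $\Lambda$. The group $G=\mathrm{GL}(3,\mathbb F)$ acts on $\Lambda$ on the right by change of basis: $\lambda g$ is the structure vector of $\Theta^{-1}(\lambda)$ relative to the basis $v_j=\sum_i g_{ij}e_i$ ($j=1,2,3$). Write $O(\lambda)=\lambda G$ for the orbit; orbits correspond to isomorphism classes of algebras. One says $\mathfrak g$ degenerates to $\mathfrak h$ if $\Theta(\mathfrak h)\in\overline{O(\Theta(\mathfrak g))}$ (Zariski closure). The algebras are given by their nonzero products of basis vectors (all other products of basis vectors being zero): $\mathfrak a_0$: none (zero algebra); $\mathfrak c_1$: $e_3e_3=e_1$; $\mathfrak c_3$: $e_2e_2=e_1$, $e_3e_3=e_1$;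 $\mathfrak a(\delta)$, $\delta\in\mathbb F$: $e_2e_2=e_1$, $e_3e_3=\delta e_1$, $e_2e_3=e_1$; $\mathfrak l_1$: $e_2e_3=e_1$, $e_3e_2=-e_1$; $\mathfrak c_5$: $e_1e_1=e_2$, $e_1e_2=e_3$, $e_2e_1=e_3$. By the known classification, over an algebraically closed field every 3-dimensional nilpotent associative algebra is isomorphic to exactly one algebra in this list (distinct $\delta$ giving non-isomorphic $\mathfrak a(\delta)$). *)

theory Defs
  imports "HOL-Analysis.Analysis" "HOL-Computational_Algebra.Polynomial"
begin

section \<open>The Zariski topology on affine space\<close>

inductive_set polynomial_functions :: "('a::field ^ 'n \<Rightarrow> 'a) set" where
  const: "(\<lambda>x. c) \<in> polynomial_functions"
| coord: "(\<lambda>x. x $ i) \<in> polynomial_functions"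
| add: "p \<in> polynomial_functions \<Longrightarrow> q \<in> polynomial_functions \<Longrightarrow> (\<lambda>x. p x + q x) \<in> polynomial_functions"
| mult: "p \<in> polynomial_functions \<Longrightarrow> q \<in> polynomial_functions \<Longrightarrow> (\<lambda>x. p x * q x) \<in> polynomial_functions"

definition zero_locus :: "('a::field ^ 'n \<Rightarrow> 'a) set \<Rightarrow> ('a ^ 'n) set" where
  "zero_locus P = {x. \<forall>p\<in>P. p x = 0}"

definition zariski :: "('a::field ^ 'n) topology" where
  "zariski = topology (\<lambda>U. \<exists>P\<subseteq>polynomial_functions. U = - zero_locus P)"

lemma openin_zariski:
  fixes U :: "('a::field ^ 'n) set"
  shows "openin zariski U \<longleftrightarrow> (\<exists>P\<subseteq>polynomial_functions. U = - zero_locus P)"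
proof -
  let ?open = "\<lambda>U :: ('a ^ 'n) set. \<exists>P\<subseteq>polynomial_functions. U = - zero_locus P"
  have "istopology ?open"
    unfolding istopology_def
  proof (intro conjI allI impI)
    fix S T :: "('a ^ 'n) set" assume "?open S" "?open T"
    then obtain P Q where P: "P \<subseteq> polynomial_functions" "S = - zero_locus P"
      and Q: "Q \<subseteq> polynomial_functions" "T = - zero_locus Q" by blast
    let ?R = "{(\<lambda>x. p x * q x) |p q. p \<in> P \<and> q \<in> Q}"
    have "?R \<subseteq> polynomial_functions"
      using P(1) Q(1) by (auto intro: polynomial_functions.mult)
    moreover have "S \<inter> T = - zero_locus ?R"
      unfolding P(2) Q(2) zero_locus_def by fastforce
    ultimately show "?open (S \<inter> T)" by blast
  next
    fix \<K> :: "('a ^ 'n) set set" assume "\<forall>K\<in>\<K>. ?open K"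
    then obtain P where P: "\<And>K. K \<in> \<K> \<Longrightarrow> P K \<subseteq> polynomial_functions \<and> K = - zero_locus (P K)"
      by metis
    have "(\<Union>K\<in>\<K>. P K) \<subseteq> polynomial_functions" using P by blast
    moreover have "\<Union>\<K> = - zero_locus (\<Union>K\<in>\<K>. P K)"
    proof -
      have "\<Union>\<K> = (\<Union>K\<in>\<K>. - zero_locus (P K))" using P by blast
      then show ?thesis by (auto simp: zero_locus_def)
    qed
    ultimately show "?open (\<Union>\<K>)" by blast
  qed
  then show ?thesis
    by (simp add: zariski_def topology_inverse')
qed

lemma topspace_zariski [simp]: "topspace zariski = (UNIV :: ('a::field ^ 'n) set)"
proof -
  have "- zero_locus {\<lambda>x. 1} = (UNIV :: ('a ^ 'n) set)" by (simp add: zero_locus_def)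
  then have "openin zariski (UNIV :: ('a ^ 'n) set)"
    unfolding openin_zariski
    by (metis empty_subsetI insert_subset polynomial_functions.const)
  then show ?thesis using openin_subset by blast
qed

lemma closedin_zariski: "closedin zariski S \<longleftrightarrow> (\<exists>P\<subseteq>polynomial_functions. S = zero_locus P)"
  by (auto simp: closedin_def openin_zariski Compl_eq_Diff_UNIV[symmetric])


section \<open>Algebra structures on a 3-dimensional space with an ordered basis\<close>

text \<open>The index type \<open>3\<close> has the elements \<open>1\<close>, \<open>2\<close> and \<open>3 = 0\<close>.\<close>

locale based_space = vector_space scale
  for scale :: "'a::field \<Rightarrow> 'v::ab_group_add \<Rightarrow> 'v" +
  fixes e :: "3 \<Rightarrow> 'v"
  assumes inj_basis: "inj e"
    and independent_basis: "independent (range e)"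
    and span_basis: "span (range e) = UNIV"

definition algebra_structure :: "('a::field \<Rightarrow> 'v::ab_group_add \<Rightarrow> 'v) \<Rightarrow> ('v \<Rightarrow> 'v \<Rightarrow> 'v) \<Rightarrow> bool" where
  "algebra_structure s mul \<longleftrightarrow>
     (\<forall>x. Vector_Spaces.linear s s (\<lambda>y. mul x y)) \<and> (\<forall>y. Vector_Spaces.linear s s (\<lambda>x. mul x y))"

definition associative :: "('v \<Rightarrow> 'v \<Rightarrow> 'v) \<Rightarrow> bool" where
  "associative mul \<longleftrightarrow> (\<forall>u v w. mul (mul u v) w = mul u (mul v w))"

definition nilpotent_algebra :: "('v::zero \<Rightarrow> 'v \<Rightarrow> 'v) \<Rightarrow> bool" where
  "nilpotent_algebra mul \<longleftrightarrow> (\<exists>r\<ge>1. \<forall>w ws. length ws = r \<longrightarrow> foldl mul w ws = 0)"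

definition coordinate :: "('a::field \<Rightarrow> 'v::ab_group_add \<Rightarrow> 'v) \<Rightarrow> (3 \<Rightarrow> 'v) \<Rightarrow> 'v \<Rightarrow> 3 \<Rightarrow> 'a" where
  "coordinate s u x i = module.representation s (range u) x (u i)"

definition structure_vector ::
  "('a::field \<Rightarrow> 'v::ab_group_add \<Rightarrow> 'v) \<Rightarrow> (3 \<Rightarrow> 'v) \<Rightarrow> ('v \<Rightarrow> 'v \<Rightarrow> 'v) \<Rightarrow> 'a ^ (3 \<times> 3 \<times> 3)" where
  "structure_vector s u mul = (\<chi> p. case p of (i, j, k) \<Rightarrow> coordinate s u (mul (u i) (u j)) k)"

definition bilinear_extension ::
  "('a::field \<Rightarrow> 'v::ab_group_add \<Rightarrow> 'v) \<Rightarrow> (3 \<Rightarrow> 'v) \<Rightarrow> (3 \<Rightarrow> 3 \<Rightarrow> 'v) \<Rightarrow> 'v \<Rightarrow> 'v \<Rightarrow> 'v" where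
  "bilinear_extension s e T x y =
     (\<Sum>i\<in>UNIV. \<Sum>j\<in>UNIV. s (coordinate s e x i * coordinate s e y j) (T i j))"

text \<open>The inverse of \<open>structure_vector s e\<close>; see \<open>bij_structure_vector\<close> and
  \<open>algebra_of_structure_vector\<close> below.\<close>

definition algebra_of ::
  "('a::field \<Rightarrow> 'v::ab_group_add \<Rightarrow> 'v) \<Rightarrow> (3 \<Rightarrow> 'v) \<Rightarrow> 'a ^ (3 \<times> 3 \<times> 3) \<Rightarrow> 'v \<Rightarrow> 'v \<Rightarrow> 'v" where
  "algebra_of s e l = bilinear_extension s e (\<lambda>i j. \<Sum>k\<in>UNIV. s (l $ (i, j, k)) (e k))"


section \<open>Change of basis, orbits and degenerations\<close>

definition change_basis ::
  "('a::field \<Rightarrow> 'v::ab_group_add \<Rightarrow> 'v) \<Rightarrow> (3 \<Rightarrow> 'v) \<Rightarrow> 'a ^ 3 ^ 3 \<Rightarrow> 3 \<Rightarrow> 'v" where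
  "change_basis s e g j = (\<Sum>i\<in>UNIV. s (g $ i $ j) (e i))"

definition act ::
  "('a::field \<Rightarrow> 'v::ab_group_add \<Rightarrow> 'v) \<Rightarrow> (3 \<Rightarrow> 'v) \<Rightarrow> 'a ^ (3 \<times> 3 \<times> 3) \<Rightarrow> 'a ^ 3 ^ 3 \<Rightarrow> 'a ^ (3 \<times> 3 \<times> 3)" where
  "act s e l g = structure_vector s (change_basis s e g) (algebra_of s e l)"

definition orbit ::
  "('a::field \<Rightarrow> 'v::ab_group_add \<Rightarrow> 'v) \<Rightarrow> (3 \<Rightarrow> 'v) \<Rightarrow> 'a ^ (3 \<times> 3 \<times> 3) \<Rightarrow> ('a ^ (3 \<times> 3 \<times> 3)) set" where
  "orbit s e l = {act s e l g |g. invertible g}"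

definition degenerates ::
  "('a::field \<Rightarrow> 'v::ab_group_add \<Rightarrow> 'v) \<Rightarrow> (3 \<Rightarrow> 'v) \<Rightarrow> ('v \<Rightarrow> 'v \<Rightarrow> 'v) \<Rightarrow> ('v \<Rightarrow> 'v \<Rightarrow> 'v) \<Rightarrow> bool" where
  "degenerates s e \<gg> \<hh> \<longleftrightarrow>
     structure_vector s e \<hh> \<in> zariski closure_of orbit s e (structure_vector s e \<gg>)"


section \<open>The algebras\<close>

definition alg_a0 :: "('a::field \<Rightarrow> 'v::ab_group_add \<Rightarrow> 'v) \<Rightarrow> (3 \<Rightarrow> 'v) \<Rightarrow> 'v \<Rightarrow> 'v \<Rightarrow> 'v" where
  "alg_a0 s e = bilinear_extension s e (\<lambda>i j. 0)"

definition alg_c1 :: "('a::field \<Rightarrow> 'v::ab_group_add \<Rightarrow> 'v) \<Rightarrow> (3 \<Rightarrow> 'v) \<Rightarrow> 'v \<Rightarrow> 'v \<Rightarrow> 'v" where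
  "alg_c1 s e = bilinear_extension s e (\<lambda>i j. if (i, j) = (3, 3) then e 1 else 0)"

definition alg_c3 :: "('a::field \<Rightarrow> 'v::ab_group_add \<Rightarrow> 'v) \<Rightarrow> (3 \<Rightarrow> 'v) \<Rightarrow> 'v \<Rightarrow> 'v \<Rightarrow> 'v" where
  "alg_c3 s e = bilinear_extension s e (\<lambda>i j.
     if (i, j) = (2, 2) then e 1 else if (i, j) = (3, 3) then e 1 else 0)"

definition alg_a :: "('a::field \<Rightarrow> 'v::ab_group_add \<Rightarrow> 'v) \<Rightarrow> (3 \<Rightarrow> 'v) \<Rightarrow> 'a \<Rightarrow> 'v \<Rightarrow> 'v \<Rightarrow> 'v" where
  "alg_a s e \<delta> = bilinear_extension s e (\<lambda>i j.
     if (i, j) = (2, 2) then e 1 else if (i, j) = (3, 3) then s \<delta> (e 1)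
     else if (i, j) = (2, 3) then e 1 else 0)"

definition alg_l1 :: "('a::field \<Rightarrow> 'v::ab_group_add \<Rightarrow> 'v) \<Rightarrow> (3 \<Rightarrow> 'v) \<Rightarrow> 'v \<Rightarrow> 'v \<Rightarrow> 'v" where
  "alg_l1 s e = bilinear_extension s e (\<lambda>i j.
     if (i, j) = (2, 3) then e 1 else if (i, j) = (3, 2) then - e 1 else 0)"

definition alg_c5 :: "('a::field \<Rightarrow> 'v::ab_group_add \<Rightarrow> 'v) \<Rightarrow> (3 \<Rightarrow> 'v) \<Rightarrow> 'v \<Rightarrow> 'v \<Rightarrow> 'v" where
  "alg_c5 s e = bilinear_extension s e (\<lambda>i j.
     if (i, j) = (1, 1) then e 2 else if (i, j) = (1, 2) then e 3
     else if (i, j) = (2, 1) then e 3 else 0)"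

definition algebra_list :: "('a::field \<Rightarrow> 'v::ab_group_add \<Rightarrow> 'v) \<Rightarrow> (3 \<Rightarrow> 'v) \<Rightarrow> ('v \<Rightarrow> 'v \<Rightarrow> 'v) set" where
  "algebra_list s e =
     {alg_a0 s e, alg_c1 s e, alg_c3 s e, alg_l1 s e, alg_c5 s e} \<union> range (alg_a s e)"


section \<open>Basic facts\<close>

context based_space
begin

lemma coordinate_add: "coordinate scale e (x + y) i = coordinate scale e x i + coordinate scale e y i"
  unfolding coordinate_def
  by (subst representation_add) (auto simp: independent_basis span_basis)

lemma coordinate_scale: "coordinate scale e (scale c x) i = c * coordinate scale e x i"
  unfolding coordinate_def
  by (subst representation_scale) (auto simp: independent_basis span_basis)

lemma coordinate_basis: "coordinate scale e (e j) i = (if i = j then 1 else 0)"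
  unfolding coordinate_def
  by (subst representation_basis) (auto simp: independent_basis inj_eq[OF inj_basis])

lemma coordinate_zero [simp]: "coordinate scale e 0 i = 0"
  unfolding coordinate_def by (simp add: representation_zero)

lemma coordinate_minus: "coordinate scale e (- x) i = - coordinate scale e x i"
  using coordinate_scale[of "-1" x i] by simp

lemma coordinate_sum: "coordinate scale e (\<Sum>a\<in>A. f a) i = (\<Sum>a\<in>A. coordinate scale e (f a) i)"
  by (induction A rule: infinite_finite_induct) (auto simp: coordinate_add)

lemma sum_coordinate: "(\<Sum>i\<in>UNIV. scale (coordinate scale e x i) (e i)) = x"
proof -
  have "(\<Sum>i\<in>UNIV. scale (coordinate scale e x i) (e i))
      = (\<Sum>b\<in>range e. scale (representation (range e) x b) b)"
    by (subst sum.reindex) (auto simp: inj_basis coordinate_def)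
  also have "\<dots> = x"
    by (rule sum_representation_eq) (auto simp: independent_basis span_basis)
  finally show ?thesis .
qed

lemma coordinate_eqI: "(\<And>i. coordinate scale e x i = coordinate scale e y i) \<Longrightarrow> x = y"
  by (metis (no_types, lifting) sum.cong sum_coordinate)

lemma linear_iff: "Vector_Spaces.linear scale scale f \<longleftrightarrow>
    (\<forall>x y. f (x + y) = f x + f y) \<and> (\<forall>c x. f (scale c x) = scale c (f x))"
  by (auto simp: Vector_Spaces.linear_iff vector_space_axioms)

lemma algebra_structure_bilinear_extension:
  "algebra_structure scale (bilinear_extension scale e T)"
  unfolding algebra_structure_def linear_iff bilinear_extension_def
  by (auto simp: coordinate_add coordinate_scale algebra_simps scale_sum_right sum.distrib)

lemma bilinear_extension_basis: "bilinear_extension scale e T (e i) (e j) = T i j"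
proof -
  have if_scale: "scale (if P then 1 else 0) x = (if P then x else 0)" for P x
    by simp
  have if_mult: "(if P then 1 else 0) * (if Q then 1 else 0) = (if P then if Q then 1 else 0 else (0::'a))"
    for P Q by simp
  have "bilinear_extension scale e T (e i) (e j)
      = (\<Sum>a\<in>UNIV. if a = i then (\<Sum>b\<in>UNIV. if b = j then T a b else 0) else 0)"
    unfolding bilinear_extension_def
    by (intro sum.cong refl) (auto simp: coordinate_basis if_mult if_scale cong: if_cong)
  then show ?thesis by simp
qed

lemma algebra_structure_eq_extension:
  assumes "algebra_structure scale mul"
  shows "mul = bilinear_extension scale e (\<lambda>i j. mul (e i) (e j))"
proof (intro ext)
  fix x y
  interpret L: Vector_Spaces.linear scale scale "\<lambda>y. mul x y" for x
    using assms by (simp add: algebra_structure_def)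
  interpret R: Vector_Spaces.linear scale scale "\<lambda>x. mul x y" for y
    using assms by (simp add: algebra_structure_def)
  let ?c = "coordinate scale e"
  have "mul x y = mul (\<Sum>i\<in>UNIV. scale (?c x i) (e i)) (\<Sum>j\<in>UNIV. scale (?c y j) (e j))"
    by (simp only: sum_coordinate)
  also have "\<dots> = bilinear_extension scale e (\<lambda>i j. mul (e i) (e j)) x y"
    by (simp add: R.sum R.scale L.sum L.scale bilinear_extension_def scale_sum_right mult.commute)
      (rule sum.swap)
  finally show "mul x y = bilinear_extension scale e (\<lambda>i j. mul (e i) (e j)) x y" .
qed

lemma algebra_of_structure_vector:
  assumes "algebra_structure scale mul"
  shows "algebra_of scale e (structure_vector scale e mul) = mul"
  using algebra_structure_eq_extension[OF assms]
  by (simp add: algebra_of_def structure_vector_def sum_coordinate)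

lemma structure_vector_algebra_of: "structure_vector scale e (algebra_of scale e l) = l"
  by (auto simp: vec_eq_iff structure_vector_def algebra_of_def bilinear_extension_basis
      coordinate_sum coordinate_scale coordinate_basis if_distrib[of "\<lambda>x. _ * x"] cong: if_cong)

lemma bij_structure_vector:
  "bij_betw (structure_vector scale e) {mul. algebra_structure scale mul} UNIV"
  by (rule bij_betw_byWitness[where f' = "algebra_of scale e"])
    (auto simp: algebra_of_structure_vector structure_vector_algebra_of,
     auto simp: algebra_of_def algebra_structure_bilinear_extension)

lemma algebra_list_nilpotent_associative:
  assumes "mul \<in> algebra_list scale e"
  shows "algebra_structure scale mul" "associative mul" "nilpotent_algebra mul"
proof -
  note defs = alg_a0_def alg_c1_def alg_c3_def alg_a_def alg_l1_def alg_c5_def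
  show "algebra_structure scale mul"
    using assms by (auto simp: algebra_list_def defs algebra_structure_bilinear_extension)
  let ?c = "coordinate scale e"
  have coord: "?c (bilinear_extension scale e T x y) k
      = (\<Sum>i\<in>UNIV. \<Sum>j\<in>UNIV. ?c x i * ?c y j * ?c (T i j) k)" for T x y k
    by (simp add: bilinear_extension_def coordinate_sum coordinate_scale)
  have rules: "?c (if P then x else y) k = (if P then ?c x k else ?c y k)" for P x y k
    by simp
  note simps = coord sum_3 rules coordinate_basis coordinate_scale coordinate_minus
  show "associative mul"
    unfolding associative_def
  proof (intro allI coordinate_eqI)
    fix u v w k
    show "?c (mul (mul u v) w) k = ?c (mul u (mul v w)) k"
      using assms exhaust_3[of k] unfolding algebra_list_def
      by (auto simp: defs simps)
  qed
  have "mul (mul (mul w x) y) z = 0" for w x y z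
  proof (rule coordinate_eqI)
    fix k
    show "?c (mul (mul (mul w x) y) z) k = ?c 0 k"
      using assms exhaust_3[of k] unfolding algebra_list_def
      by (auto simp: defs simps)
  qed
  then have "\<forall>w ws. length ws = 3 \<longrightarrow> foldl mul w ws = 0"
    by (auto simp: numeral_3_eq_3 length_Suc_conv)
  then show "nilpotent_algebra mul"
    unfolding nilpotent_algebra_def by (intro exI[of _ 3]) auto
qed

end

end

theory Submission
  imports Defs
begin

text \<open>
  A degeneration is exhibited by a curve of structure vectors that is polynomial in \<open>t\<close> and lies
  in the orbit for \<open>t \<noteq> 0\<close>: over an infinite field, its value at \<open>t = 0\<close> lies in the Zariski
  closure. Non-degenerations are certified by polynomial identities between structure constants
  that hold in every basis: commutativity, vanishing of squares, vanishing of all triple products, and,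
  for the product \<open>uv = B(u, v) e\<^sub>1\<close> of \<open>\<aa>(\<delta>)\<close>, the relation
  \<open>B(u,u) B(v,v) - B(u,v) B(v,u) = \<delta> (B(u,v) - B(v,u))\<^sup>2\<close>, which determines \<open>\<delta>\<close>
  and whose two sides both vanish for \<open>\<cc>\<^sub>1\<close>.
\<close>

section \<open>Zariski closure\<close>

lemma polynomial_functions_diff:
  assumes "p \<in> polynomial_functions" "q \<in> polynomial_functions"
  shows "(\<lambda>x. p x - q x) \<in> polynomial_functions"
  using polynomial_functions.add[OF assms(1)
      polynomial_functions.mult[OF polynomial_functions.const[of "-1"] assms(2)]]
  by simp

lemma polynomial_functions_sum:
  assumes "\<And>a. a \<in> A \<Longrightarrow> f a \<in> polynomial_functions"
  shows "(\<lambda>x. \<Sum>a\<in>A. f a x) \<in> polynomial_functions"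
  using assms
  by (induction A rule: infinite_finite_induct)
    (auto intro: polynomial_functions.const polynomial_functions.add)

lemmas polynomial_functions_intros =
  polynomial_functions.intros polynomial_functions_diff polynomial_functions_sum

text \<open>The closure is itself the zero locus of some family of polynomials, each of which
  vanishes on \<open>S\<close>, so testing one polynomial at a time suffices.\<close>

lemma in_zariski_closure_iff:
  "x \<in> zariski closure_of S \<longleftrightarrow>
     (\<forall>p\<in>polynomial_functions. (\<forall>y\<in>S. p y = 0) \<longrightarrow> p x = 0)"
proof (intro iffI ballI impI)
  fix p :: "'a ^ 'b \<Rightarrow> 'a"
  assume x: "x \<in> zariski closure_of S" and p: "p \<in> polynomial_functions" "\<forall>y\<in>S. p y = 0"
  have "closedin zariski (zero_locus {p})"
    using p(1) by (auto simp: closedin_zariski)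
  moreover have "S \<subseteq> zero_locus {p}"
    using p(2) by (auto simp: zero_locus_def)
  ultimately have "zariski closure_of S \<subseteq> zero_locus {p}"
    by (rule closure_of_minimal[rotated])
  with x show "p x = 0" by (auto simp: zero_locus_def)
next
  assume *: "\<forall>p\<in>polynomial_functions. (\<forall>y\<in>S. p y = 0) \<longrightarrow> p x = 0"
  obtain P where P: "P \<subseteq> polynomial_functions" "zariski closure_of S = zero_locus P"
    using closedin_closure_of[of zariski S] unfolding closedin_zariski by blast
  have "S \<subseteq> zero_locus P"
    using closure_of_subset[of S zariski] P(2) by simp
  then have "x \<in> zero_locus P"
    using * P(1) unfolding zero_locus_def by blast
  with P(2) show "x \<in> zariski closure_of S" by simp
qed

lemma polynomial_function_on_curve:
  assumes "p \<in> polynomial_functions" and "\<And>i t. \<phi> t $ i = poly (q i) t"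
  shows "\<exists>r. \<forall>t. p (\<phi> t) = poly r t"
  using assms(1)
proof induction
  case (const c)
  show ?case by (rule exI[of _ "[:c:]"]) simp
next
  case (coord i)
  show ?case using assms(2) by blast
next
  case (add f g)
  then show ?case by (metis poly_add)
next
  case (mult f g)
  then show ?case by (metis poly_mult)
qed

text \<open>A polynomial vanishing on \<open>S\<close> pulls back along the curve to a one-variable
  polynomial with every nonzero \<open>t\<close> as a root. Infinitely many roots force it to be
  zero, in particular at \<open>t = 0\<close>.\<close>

lemma zariski_closure_curve:
  fixes \<phi> :: "'a::field \<Rightarrow> 'a ^ 'n"
  assumes inf: "infinite (UNIV :: 'a set)"
    and curve: "\<And>i t. \<phi> t $ i = poly (q i) t"
    and S: "\<And>t. t \<noteq> 0 \<Longrightarrow> \<phi> t \<in> S"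
  shows "\<phi> 0 \<in> zariski closure_of S"
  unfolding in_zariski_closure_iff
proof (intro ballI impI)
  fix p :: "'a ^ 'n \<Rightarrow> 'a"
  assume p: "p \<in> polynomial_functions" "\<forall>y\<in>S. p y = 0"
  obtain r where r: "\<And>t. p (\<phi> t) = poly r t"
    using polynomial_function_on_curve[OF p(1), of \<phi> q] curve by blast
  have "UNIV - {0} \<subseteq> {t. poly r t = 0}"
    using S p(2) r by force
  moreover have "infinite (UNIV - {0 :: 'a})"
    using inf by simp
  ultimately have "infinite {t. poly r t = 0}"
    using infinite_super by blast
  then have "r = 0"
    using poly_roots_finite by blast
  then show "p (\<phi> 0) = 0" by (simp add: r)
qed

text \<open>Over a finite field, the product of all X - a plus 1 would be nonconstant yet take only
  the value 1, so it would have no root.\<close>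

lemma infinite_UNIV_alg_closed: "infinite (UNIV :: 'a::alg_closed_field set)"
proof
  assume fin: "finite (UNIV :: 'a set)"
  let ?f = "\<Prod>a\<in>UNIV. [:- a, 1:] :: 'a poly"
  have deg: "degree ?f = card (UNIV :: 'a set)"
    by (subst degree_prod_eq_sum_degree) auto
  have "card (UNIV :: 'a set) > 0"
    using fin by (simp add: card_gt_0_iff)
  then have "degree (?f + 1) > 0"
    using deg by (subst degree_add_eq_left) auto
  then obtain x where "poly (?f + 1) x = 0"
    using alg_closed_imp_poly_has_root by blast
  moreover have "poly ?f x = 0"
    using fin by (auto simp: poly_prod)
  ultimately show False by simp
qed


section \<open>Orbits in terms of bases\<close>

context based_space
begin

lemma coordinate_bilinear_extension:
  "coordinate scale e (bilinear_extension scale e T x y) k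
    = (\<Sum>i\<in>UNIV. \<Sum>j\<in>UNIV. coordinate scale e x i * coordinate scale e y j * coordinate scale e (T i j) k)"
  by (simp add: bilinear_extension_def coordinate_sum coordinate_scale)

lemma coordinate_change_basis: "coordinate scale e (change_basis scale e g j) i = g $ i $ j"
  by (simp add: change_basis_def coordinate_sum coordinate_scale coordinate_basis
      if_distrib[of "\<lambda>x. _ * x"] cong: if_cong)

text \<open>The combination of the new vectors with coefficients \<open>c\<close> has old
  coordinates \<open>g *v c\<close>. A left inverse of \<open>g\<close> therefore gives
  independence, and the columns of a right inverse express the old basis in the new vectors.\<close>

lemma based_space_change_basis:
  assumes "invertible g"
  shows "based_space scale (change_basis scale e g)"
proof -
  let ?u = "change_basis scale e g"
  obtain h where gh: "g ** h = mat 1" and hg: "h ** g = mat 1"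
    using assms by (auto simp: invertible_def)
  have indep: "c = 0" if "(\<Sum>i\<in>UNIV. scale (c $ i) (?u i)) = 0" for c :: "'a ^ 3"
  proof -
    have "(g *v c) $ k = coordinate scale e (\<Sum>i\<in>UNIV. scale (c $ i) (?u i)) k" for k
      by (simp add: coordinate_sum coordinate_scale coordinate_change_basis
          matrix_vector_mult_def mult.commute)
    then have "g *v c = 0"
      by (simp add: that vec_eq_iff)
    then have "(h ** g) *v c = 0"
      by (simp flip: matrix_vector_mul_assoc)
    then show "c = 0" by (simp add: hg)
  qed
  have inj: "inj ?u"
  proof (rule injI, rule ccontr)
    fix i j assume ij: "?u i = ?u j" "i \<noteq> j"
    \<comment> \<open>Two equal vectors with different indices would give a nontrivial relation,
      with coefficients 1 and -1.\<close>
    have "(\<Sum>k\<in>UNIV. scale ((axis i 1 - axis j 1) $ k) (?u k))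
        = (\<Sum>k\<in>UNIV. (if k = i then ?u k else 0) - (if k = j then ?u k else 0))"
      by (intro sum.cong refl) (auto simp: axis_def)
    also have "\<dots> = 0" using ij(1) by (simp add: sum_subtractf)
    finally have "axis i 1 - axis j 1 = (0 :: 'a ^ 3)" by (rule indep)
    with ij(2) show False by (simp add: axis_eq_axis)
  qed
  have "independent (range ?u)"
  proof
    assume "dependent (range ?u)"
    then obtain c v where c: "v \<in> range ?u" "c v \<noteq> 0" "(\<Sum>w\<in>range ?u. scale (c w) w) = 0"
      by (auto simp: dependent_finite)
    have "(\<Sum>i\<in>UNIV. scale ((\<chi> i. c (?u i)) $ i) (?u i)) = 0"
      using c(3) by (simp add: sum.reindex[OF inj])
    then have "(\<chi> i. c (?u i)) = 0" by (rule indep)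
    with c(1,2) show False by (auto simp: vec_eq_iff)
  qed
  moreover have "span (range ?u) = UNIV"
  proof -
    have "e j \<in> span (range ?u)" for j
    proof -
      have "coordinate scale e (\<Sum>i\<in>UNIV. scale (h $ i $ j) (?u i)) k = (g ** h) $ k $ j" for k
        by (simp add: coordinate_sum coordinate_scale coordinate_change_basis
            matrix_matrix_mult_def mult.commute)
      then have "(\<Sum>i\<in>UNIV. scale (h $ i $ j) (?u i)) = e j"
        by (intro coordinate_eqI) (simp add: gh mat_def coordinate_basis)
      moreover have "(\<Sum>i\<in>UNIV. scale (h $ i $ j) (?u i)) \<in> span (range ?u)"
        by (intro span_sum span_scale span_base) auto
      ultimately show ?thesis by simp
    qed
    then have "span (range e) \<subseteq> span (range ?u)"
      by (intro span_minimal subspace_span) auto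
    then show ?thesis by (auto simp: span_basis)
  qed
  ultimately show ?thesis
    using inj by unfold_locales
qed

lemma structure_vector_eqI:
  assumes "\<And>i j. mul (e i) (e j) = (\<Sum>k\<in>UNIV. scale (l $ (i, j, k)) (e k))"
  shows "structure_vector scale e mul = l"
  by (auto simp: vec_eq_iff structure_vector_def assms coordinate_sum coordinate_scale
      coordinate_basis if_distrib[of "\<lambda>x. _ * x"] cong: if_cong)

lemma orbit_structure_vector:
  assumes "algebra_structure scale mul"
  shows "orbit scale e (structure_vector scale e mul)
    = {structure_vector scale (change_basis scale e g) mul |g. invertible g}"
  by (simp add: orbit_def act_def algebra_of_structure_vector[OF assms])

text \<open>The columns of \<open>g t\<close> are the new basis and \<open>q i j k\<close> its
  structure constants. Only the latter must be polynomial in \<open>t\<close>, so \<open>g\<close>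
  may have poles at 0. The premise \<open>mult\<close> compares products in old coordinates, which
  avoids inverting \<open>g t\<close>.\<close>

lemma degenerates_bilinear_extensionI:
  fixes g :: "'a \<Rightarrow> 'a ^ 3 ^ 3" and q :: "3 \<Rightarrow> 3 \<Rightarrow> 3 \<Rightarrow> 'a poly"
  assumes inf: "infinite (UNIV :: 'a set)"
    and det: "\<And>t. t \<noteq> 0 \<Longrightarrow> det (g t) \<noteq> 0"
    and mult: "\<And>t. t \<noteq> 0 \<Longrightarrow> \<forall>i j m.
      (\<Sum>a\<in>UNIV. \<Sum>b\<in>UNIV. g t $ a $ i * g t $ b $ j * coordinate scale e (T a b) m)
        = (\<Sum>k\<in>UNIV. poly (q i j k) t * g t $ m $ k)"
    and limit: "\<forall>i j k. poly (q i j k) 0 = coordinate scale e (T' i j) k"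
  shows "degenerates scale e (bilinear_extension scale e T) (bilinear_extension scale e T')"
proof -
  let ?mul = "bilinear_extension scale e T"
  define \<phi> :: "'a \<Rightarrow> 'a ^ (3 \<times> 3 \<times> 3)" where
    "\<phi> t = (\<chi> p. poly (case p of (i, j, k) \<Rightarrow> q i j k) t)" for t
  have "\<phi> t \<in> orbit scale e (structure_vector scale e ?mul)" if t: "t \<noteq> 0" for t
  proof -
    let ?u = "change_basis scale e (g t)"
    have inv: "invertible (g t)"
      using det[OF t] by (simp add: invertible_det_nz)
    interpret u: based_space scale ?u
      by (rule based_space_change_basis[OF inv])
    have "structure_vector scale ?u ?mul = \<phi> t"
      by (intro u.structure_vector_eqI coordinate_eqI)
        (simp add: coordinate_bilinear_extension coordinate_sum coordinate_scale
          coordinate_change_basis mult[OF t, rule_format] \<phi>_def)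
    then show ?thesis
      unfolding orbit_structure_vector[OF algebra_structure_bilinear_extension] mem_Collect_eq
      using inv by (intro exI[of _ "g t"]) simp
  qed
  moreover have "\<phi> t $ p = poly (case p of (i, j, k) \<Rightarrow> q i j k) t" for t p
    by (simp add: \<phi>_def)
  ultimately have "\<phi> 0 \<in> zariski closure_of orbit scale e (structure_vector scale e ?mul)"
    using zariski_closure_curve[OF inf] by blast
  moreover have "\<phi> 0 = structure_vector scale e (bilinear_extension scale e T')"
    by (auto simp: \<phi>_def vec_eq_iff structure_vector_def bilinear_extension_basis limit)
  ultimately show ?thesis by (simp add: degenerates_def)
qed

text \<open>Points of the orbit are structure vectors of \<open>mul\<close> in other bases, so a
  relation checked in every basis vanishes on the orbit and hence on its closure. All obstructions
  below go through this.\<close>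

lemma degenerates_vanishing:
  assumes "degenerates scale e mul mul'" and "algebra_structure scale mul"
    and "p \<in> polynomial_functions"
    and "\<And>u. based_space scale u \<Longrightarrow> p (structure_vector scale u mul) = 0"
  shows "p (structure_vector scale e mul') = 0"
  using assms based_space_change_basis
  by (force simp: degenerates_def in_zariski_closure_iff orbit_structure_vector)


section \<open>Identities preserved by degeneration\<close>

lemma structure_vector_nth [simp]:
  "structure_vector scale u mul $ (i, j, k) = coordinate scale u (mul (u i) (u j)) k"
  by (simp add: structure_vector_def)

lemma degenerates_commutative:
  assumes "degenerates scale e mul mul'" and "algebra_structure scale mul"
    and "\<And>x y. mul x y = mul y x"
  shows "mul' (e i) (e j) = mul' (e j) (e i)"
proof (rule coordinate_eqI)
  fix k
  show "coordinate scale e (mul' (e i) (e j)) k = coordinate scale e (mul' (e j) (e i)) k"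
    using degenerates_vanishing[OF assms(1,2), of "\<lambda>l. l $ (i, j, k) - l $ (j, i, k)"] assms(3)
    by (simp add: polynomial_functions_intros)
qed

lemma degenerates_alternating:
  assumes "degenerates scale e mul mul'" and "algebra_structure scale mul"
    and "\<And>x. mul x x = 0"
  shows "mul' (e i) (e i) = 0"
proof (rule coordinate_eqI)
  fix k
  have "coordinate scale u 0 k = 0" if "based_space scale u" for u
    using that by (rule based_space.coordinate_zero)
  then show "coordinate scale e (mul' (e i) (e i)) k = coordinate scale e 0 k"
    using degenerates_vanishing[OF assms(1,2), of "\<lambda>l. l $ (i, i, k)"] assms(3)
    by (simp add: polynomial_functions_intros)
qed

lemma coordinate_mult_left:
  assumes "algebra_structure scale mul"
  shows "coordinate scale e (mul x (e j)) l
    = (\<Sum>m\<in>UNIV. coordinate scale e x m * coordinate scale e (mul (e m) (e j)) l)"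
proof -
  interpret R: Vector_Spaces.linear scale scale "\<lambda>x. mul x y" for y
    using assms by (simp add: algebra_structure_def)
  have "mul x (e j) = mul (\<Sum>m\<in>UNIV. scale (coordinate scale e x m) (e m)) (e j)"
    by (simp only: sum_coordinate)
  then show ?thesis
    by (simp add: R.sum R.scale coordinate_sum coordinate_scale)
qed

lemma degenerates_triple_product_zero:
  assumes deg: "degenerates scale e mul mul'"
    and alg: "algebra_structure scale mul" "algebra_structure scale mul'"
    and zero: "\<And>x y z. mul (mul x y) z = 0"
  shows "mul' (mul' (e i) (e j)) (e k) = 0"
proof (rule coordinate_eqI)
  fix l
  \<comment> \<open>Expanding the inner product in the basis makes each coordinate of a triple
    product a quadratic polynomial in the structure constants.\<close>
  let ?p = "\<lambda>x. \<Sum>m\<in>UNIV. x $ (i, j, m) * x $ (m, k, l)"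
  have eq: "?p (structure_vector scale u \<mu>) = coordinate scale u (\<mu> (\<mu> (u i) (u j)) (u k)) l"
    if "based_space scale u" "algebra_structure scale \<mu>" for u \<mu>
    unfolding structure_vector_nth by (rule based_space.coordinate_mult_left[OF that, symmetric])
  have "?p (structure_vector scale e mul') = 0"
  proof (rule degenerates_vanishing[OF deg alg(1)])
    show "?p (structure_vector scale u mul) = 0" if "based_space scale u" for u
      unfolding eq[OF that alg(1)] zero using that by (rule based_space.coordinate_zero)
  qed (intro polynomial_functions_intros)
  then show "coordinate scale e (mul' (mul' (e i) (e j)) (e k)) l = coordinate scale e 0 l"
    using eq[OF based_space_axioms alg(2)] by simp
qed

text \<open>In a basis \<open>u\<close> the structure constants with last index \<open>k\<close> are
  the values of \<open>B\<close> times the single scalar \<open>coordinate scale u w k\<close>. The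
  relation on \<open>B\<close> is homogeneous quadratic, so it is merely multiplied by the square of
  that scalar.\<close>

lemma degenerates_form_identity:
  assumes deg: "degenerates scale e mul mul'" and alg: "algebra_structure scale mul"
    and mul: "\<And>x y. mul x y = scale (B x y) w"
    and B: "\<And>x y. B x x * B y y - B x y * B y x = d * (B x y - B y x)\<^sup>2"
  shows "coordinate scale e (mul' (e i) (e i)) k * coordinate scale e (mul' (e j) (e j)) k
      - coordinate scale e (mul' (e i) (e j)) k * coordinate scale e (mul' (e j) (e i)) k
    = d * (coordinate scale e (mul' (e i) (e j)) k - coordinate scale e (mul' (e j) (e i)) k)\<^sup>2"
proof -
  let ?p = "\<lambda>l. l $ (i, i, k) * l $ (j, j, k) - l $ (i, j, k) * l $ (j, i, k)
    - d * ((l $ (i, j, k) - l $ (j, i, k)) * (l $ (i, j, k) - l $ (j, i, k)))"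
  have "?p (structure_vector scale e mul') = 0"
  proof (rule degenerates_vanishing[OF deg alg])
    fix u assume "based_space scale u"
    then interpret u: based_space scale u .
    let ?c = "coordinate scale u w k"
    have "?p (structure_vector scale u mul)
        = ?c\<^sup>2 * (B (u i) (u i) * B (u j) (u j) - B (u i) (u j) * B (u j) (u i)
            - d * (B (u i) (u j) - B (u j) (u i))\<^sup>2)"
      by (simp add: mul u.coordinate_scale power2_eq_square algebra_simps)
    then show "?p (structure_vector scale u mul) = 0"
      by (simp add: B)
  qed (intro polynomial_functions_intros)
  then show ?thesis by (simp add: power2_eq_square)
qed


section \<open>Degenerations in the list\<close>

lemmas if_coordinate = if_distrib[of "\<lambda>x. coordinate scale e x k" for k]

lemmas coordinate_simps =
  sum_3 det_3 if_coordinate coordinate_basis coordinate_scale coordinate_minus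

lemma degenerates_a0:
  assumes "infinite (UNIV :: 'a set)" and "algebra_structure scale mul"
  shows "degenerates scale e mul (alg_a0 scale e)"
proof -
  have "degenerates scale e (bilinear_extension scale e (\<lambda>i j. mul (e i) (e j))) (alg_a0 scale e)"
    \<comment> \<open>In the basis \<open>t e\<^sub>i\<close>, given by the scalar matrix
      \<open>mat t\<close>, every structure constant is multiplied by \<open>t\<close>.\<close>
    unfolding alg_a0_def
    by (rule degenerates_bilinear_extensionI[OF assms(1), where g = mat and
          q = "\<lambda>i j k. [:0, coordinate scale e (mul (e i) (e j)) k:]"])
      (auto simp: det_3 mat_def if_distrib[of "\<lambda>x. x * _"] if_distrib[of "\<lambda>x. _ * x"] cong: if_cong)
  then show ?thesis
    by (simp only: algebra_structure_eq_extension[OF assms(2), symmetric])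
qed

lemma degenerates_c3_c1:
  assumes "infinite (UNIV :: 'a set)"
  shows "degenerates scale e (alg_c3 scale e) (alg_c1 scale e)"
  \<comment> \<open>The basis is \<open>e\<^sub>1, t e\<^sub>2, e\<^sub>3\<close>; the square of the
    second vector is \<open>t\<^sup>2 e\<^sub>1\<close>, which disappears in the limit.\<close>
  unfolding alg_c3_def alg_c1_def
  by (rule degenerates_bilinear_extensionI[OF assms,
        where g = "\<lambda>t. vector [vector [1, 0, 0], vector [0, t, 0], vector [0, 0, 1]]" and
        q = "\<lambda>i j k. if (i, j, k) = (3, 3, 1) then 1 else if (i, j, k) = (2, 2, 1) then [:0, 0, 1:] else 0"])
   (simp_all add: coordinate_simps forall_3)

lemma degenerates_c5_c1:
  assumes "infinite (UNIV :: 'a set)"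
  shows "degenerates scale e (alg_c5 scale e) (alg_c1 scale e)"
  \<comment> \<open>The basis is \<open>e\<^sub>2, e\<^sub>3 / t, e\<^sub>1\<close>: the third
    vector squares to the first, and the products of the first and third are \<open>t\<close> times
    the second.\<close>
  unfolding alg_c5_def alg_c1_def
  by (rule degenerates_bilinear_extensionI[OF assms,
        where g = "\<lambda>t. vector [vector [0, 0, 1], vector [1, 0, 0], vector [0, inverse t, 0]]" and
        q = "\<lambda>i j k. if (i, j, k) = (3, 3, 1) then 1
          else if (i, j, k) = (1, 3, 2) \<or> (i, j, k) = (3, 1, 2) then [:0, 1:] else 0"])
   (simp_all add: coordinate_simps forall_3)

text \<open>In \<open>\<cc>\<^sub>5\<close> put \<open>p = e\<^sub>1\<close>, \<open>q = e\<^sub>2 / t\<close>, \<open>r = e\<^sub>3 / t\<close>, so that \<open>pp = t q\<close>, \<open>pq = qp = r\<close>,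
  \<open>qq = 0\<close>. As \<open>t\<close> tends to \<open>0\<close> this becomes a hyperbolic plane, which
  \<open>p + q/2\<close> and \<open>\<iota> (p - q/2)\<close> diagonalise.\<close>

lemma degenerates_c5_c3:
  assumes "infinite (UNIV :: 'a set)" and "(2 :: 'a) \<noteq> 0" and \<iota>: "\<iota> * \<iota> = (-1 :: 'a)"
  shows "degenerates scale e (alg_c5 scale e) (alg_c3 scale e)"
proof -
  have sq: "\<iota> * (\<iota> * x) = - x" for x
    by (simp add: \<iota> flip: mult.assoc)
  have "\<iota> \<noteq> 0" using \<iota> by auto
  then show ?thesis
    \<comment> \<open>With basis \<open>u\<^sub>1 = r\<close>, \<open>u\<^sub>2 = p + q/2\<close>,
      \<open>u\<^sub>3 = \<iota> (p - q/2)\<close>, the squares of \<open>u\<^sub>2\<close> and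
      \<open>u\<^sub>3\<close> are \<open>r + t q\<close> and \<open>r - t q\<close>, and their
      mixed products are \<open>\<iota> t q\<close>. Since
      \<open>q = u\<^sub>2 + \<iota> u\<^sub>3\<close>, the error terms carry the factor 1 at
      \<open>k = 2\<close> and \<open>\<iota>\<close> at \<open>k = 3\<close>.\<close>
    unfolding alg_c5_def alg_c3_def using assms(2)
    by (intro degenerates_bilinear_extensionI[OF assms(1),
          where g = "\<lambda>t. vector [vector [0, 1, \<iota>], vector [0, 1 / (2 * t), - \<iota> / (2 * t)], vector [1 / t, 0, 0]]" and
          q = "\<lambda>i j k. if k = 1 then if (i, j) = (2, 2) \<or> (i, j) = (3, 3) then 1 else 0
            else if i = 1 \<or> j = 1 then 0
            else (if k = 2 then 1 else [:\<iota>:]) * (if i = j then if i = 2 then [:0, 1:] else [:0, -1:] else [:0, \<iota>:])"])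
      (simp_all add: coordinate_simps forall_3 field_simps \<iota> sq)
qed

lemma degenerates_a_c1:
  assumes "infinite (UNIV :: 'a set)"
  shows "degenerates scale e (alg_a scale e \<delta>) (alg_c1 scale e)"
  \<comment> \<open>The basis is \<open>e\<^sub>1, t e\<^sub>3, e\<^sub>2\<close>; all products
    involving the second vector are divisible by \<open>t\<close>.\<close>
  unfolding alg_a_def alg_c1_def
  by (rule degenerates_bilinear_extensionI[OF assms,
        where g = "\<lambda>t. vector [vector [1, 0, 0], vector [0, 0, 1], vector [0, t, 0]]" and
        q = "\<lambda>i j k. if (i, j, k) = (3, 3, 1) then 1 else if (i, j, k) = (2, 2, 1) then [:0, 0, \<delta>:]
          else if (i, j, k) = (3, 2, 1) then [:0, 1:] else 0"])
   (simp_all add: coordinate_simps forall_3)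

text \<open>For \<open>\<delta> = 1/4\<close> the symmetric part of the form has the radical vector \<open>2 e\<^sub>3 - e\<^sub>2\<close>;
  the basis scales it by \<open>1 / t\<close> and \<open>e\<^sub>2\<close> by \<open>t\<close>, which kills the symmetric part in the limit.\<close>

lemma degenerates_a_l1:
  assumes "infinite (UNIV :: 'a set)" and "(2 :: 'a) \<noteq> 0" and "\<delta> = inverse 4"
  shows "degenerates scale e (alg_a scale e \<delta>) (alg_l1 scale e)"
proof -
  have "(4 :: 'a) \<noteq> 0" using assms(2) by (metis mult_2 mult_eq_0_iff numeral_code(2))
  with assms(2) show ?thesis
    unfolding alg_a_def alg_l1_def assms(3)
    by (intro degenerates_bilinear_extensionI[OF assms(1),
          where g = "\<lambda>t. vector [vector [1, 0, 0], vector [0, t, - inverse t], vector [0, 0, 2 * inverse t]]" and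
          q = "\<lambda>i j k. if (i, j, k) = (2, 2, 1) then [:0, 0, 1:] else if (i, j, k) = (2, 3, 1) then 1
            else if (i, j, k) = (3, 2, 1) then -1 else 0"])
     (simp_all add: coordinate_simps forall_3 field_simps)
qed


section \<open>Non-degenerations in the list\<close>

lemmas list_defs = alg_a0_def alg_c1_def alg_c3_def alg_a_def alg_l1_def alg_c5_def

lemma basis_nonzero [simp]: "e i \<noteq> 0"
  using coordinate_basis[of i i] by (metis coordinate_zero zero_neq_one)

section \<open>Obstructions from commutativity, squares and triple products\<close>

lemma commutative_list:
  assumes "mul \<in> {alg_a0 scale e, alg_c1 scale e, alg_c3 scale e, alg_c5 scale e}"
  shows "mul x y = mul y x"
proof (rule coordinate_eqI)
  fix k
  show "coordinate scale e (mul x y) k = coordinate scale e (mul y x) k"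
    using assms exhaust_3[of k]
    by (auto simp: list_defs coordinate_bilinear_extension coordinate_simps mult.commute)
qed

lemma alternating_list:
  assumes "mul \<in> {alg_a0 scale e, alg_l1 scale e}"
  shows "mul x x = 0"
proof (rule coordinate_eqI)
  fix k
  show "coordinate scale e (mul x x) k = coordinate scale e 0 k"
    using assms exhaust_3[of k]
    by (auto simp: list_defs coordinate_bilinear_extension coordinate_simps mult.commute)
qed

lemma triple_product_zero_list:
  assumes "mul \<in> {alg_c1 scale e, alg_c3 scale e, alg_a scale e \<delta>}"
  shows "mul (mul x y) z = 0"
proof (rule coordinate_eqI)
  fix k
  show "coordinate scale e (mul (mul x y) z) k = coordinate scale e 0 k"
    using assms exhaust_3[of k]
    by (auto simp: list_defs coordinate_bilinear_extension coordinate_simps)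
qed

lemma not_degenerates_commutative:
  assumes "mul \<in> {alg_a0 scale e, alg_c1 scale e, alg_c3 scale e, alg_c5 scale e}"
    and "algebra_structure scale mul"
  shows "\<not> degenerates scale e mul (alg_a scale e \<delta>)"
    and "(2 :: 'a) \<noteq> 0 \<Longrightarrow> \<not> degenerates scale e mul (alg_l1 scale e)"
proof -
  \<comment> \<open>Both targets fail to commute at \<open>e\<^sub>2, e\<^sub>3\<close>: the two
    products are \<open>e\<^sub>1\<close> and 0 in \<aa>(\<delta>), and \<open>e\<^sub>1\<close> and
    \<open>- e\<^sub>1\<close> in the other, which differ because 2 is nonzero.\<close>
  note comm = degenerates_commutative[OF _ assms(2) commutative_list[OF assms(1)], of _ 2 3]
  show "\<not> degenerates scale e mul (alg_a scale e \<delta>)"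
    using comm[of "alg_a scale e \<delta>"] by (auto simp: list_defs bilinear_extension_basis)
  assume "(2 :: 'a) \<noteq> 0"
  moreover have "2 = (0 :: 'a)" if "e 1 = - e 1"
    using arg_cong[OF that, of "\<lambda>x. coordinate scale e x 1"]
    by (simp add: coordinate_basis coordinate_minus eq_neg_iff_add_eq_0)
  ultimately show "\<not> degenerates scale e mul (alg_l1 scale e)"
    using comm[of "alg_l1 scale e"] by (auto simp: list_defs bilinear_extension_basis)
qed

text \<open>Each target has a basis vector with nonzero square: the third, second, first and second
  respectively.\<close>

lemma not_degenerates_alternating:
  assumes "mul \<in> {alg_a0 scale e, alg_l1 scale e}" and "algebra_structure scale mul"
    and "mul' \<in> {alg_c1 scale e, alg_c3 scale e, alg_c5 scale e, alg_a scale e \<delta>}"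
  shows "\<not> degenerates scale e mul mul'"
  using degenerates_alternating[OF _ assms(2) alternating_list[OF assms(1)], of mul' 1]
    degenerates_alternating[OF _ assms(2) alternating_list[OF assms(1)], of mul' 2]
    degenerates_alternating[OF _ assms(2) alternating_list[OF assms(1)], of mul' 3] assms(3)
  by (auto simp: list_defs bilinear_extension_basis)

lemma not_degenerates_c5:
  assumes "mul \<in> {alg_c1 scale e, alg_c3 scale e, alg_a scale e \<delta>}"
    and "algebra_structure scale mul"
  shows "\<not> degenerates scale e mul (alg_c5 scale e)"
proof
  assume "degenerates scale e mul (alg_c5 scale e)"
  moreover have "algebra_structure scale (alg_c5 scale e)"
    by (simp add: alg_c5_def algebra_structure_bilinear_extension)
  \<comment> \<open>Here the left side equals
    \<open>e\<^sub>2 e\<^sub>1 = e\<^sub>3\<close>.\<close>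
  ultimately have "alg_c5 scale e (alg_c5 scale e (e 1) (e 1)) (e 1) = 0"
    using degenerates_triple_product_zero assms(2) triple_product_zero_list[OF assms(1)] by blast
  then show False by (simp add: list_defs bilinear_extension_basis)
qed

section \<open>Obstructions from the quadratic relation on bilinear forms\<close>

lemma c1_form_identity:
  assumes "degenerates scale e (alg_c1 scale e) mul"
  shows "coordinate scale e (mul (e i) (e i)) k * coordinate scale e (mul (e j) (e j)) k
    = coordinate scale e (mul (e i) (e j)) k * coordinate scale e (mul (e j) (e i)) k"
proof -
  \<comment> \<open>This form has rank one, so all its 2 by 2 Gram determinants vanish and
    \<open>d = 0\<close> works.\<close>
  let ?B = "\<lambda>x y. coordinate scale e x 3 * coordinate scale e y 3"
  have "alg_c1 scale e x y = scale (?B x y) (e 1)" for x y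
    by (simp add: alg_c1_def bilinear_extension_def sum_3)
  moreover have "?B x x * ?B y y - ?B x y * ?B y x = 0 * (?B x y - ?B y x)\<^sup>2" for x y
    by (simp add: algebra_simps)
  moreover have "algebra_structure scale (alg_c1 scale e)"
    by (simp add: alg_c1_def algebra_structure_bilinear_extension)
  ultimately show ?thesis
    using degenerates_form_identity[OF assms, where B = ?B and w = "e 1" and d = 0] by simp
qed

lemma not_degenerates_c1_c3: "\<not> degenerates scale e (alg_c1 scale e) (alg_c3 scale e)"
  \<comment> \<open>The instance is \<open>i = 2\<close>, \<open>k = 1\<close>,
    \<open>j = 3\<close>; for the target it would read \<open>1 * 1 = 0 * 0\<close>.\<close>
  using c1_form_identity[of "alg_c3 scale e" 2 1 3]
  by (auto simp: alg_c3_def bilinear_extension_basis coordinate_basis)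

text \<open>On the coordinates 2 and 3 the form has matrix with rows (1, 1) and (0, \<delta>), of
  determinant \<delta>. The Gram determinant of x, y is thus \<delta> times the square of the minor
  x2 y3 - x3 y2, and this minor is exactly B(x,y) - B(y,x).\<close>

lemma a_form_identity:
  assumes "degenerates scale e (alg_a scale e \<delta>) mul"
  shows "coordinate scale e (mul (e i) (e i)) k * coordinate scale e (mul (e j) (e j)) k
      - coordinate scale e (mul (e i) (e j)) k * coordinate scale e (mul (e j) (e i)) k
    = \<delta> * (coordinate scale e (mul (e i) (e j)) k - coordinate scale e (mul (e j) (e i)) k)\<^sup>2"
proof (rule degenerates_form_identity[OF assms])
  let ?c = "coordinate scale e"
  let ?B = "\<lambda>x y. ?c x 2 * ?c y 2 + \<delta> * (?c x 3 * ?c y 3) + ?c x 2 * ?c y 3"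
  show "algebra_structure scale (alg_a scale e \<delta>)"
    by (simp add: alg_a_def algebra_structure_bilinear_extension)
  show "alg_a scale e \<delta> x y = scale (?B x y) (e 1)" for x y
    by (simp add: alg_a_def bilinear_extension_def sum_3 scale_left_distrib algebra_simps)
  show "?B x x * ?B y y - ?B x y * ?B y x = \<delta> * (?B x y - ?B y x)\<^sup>2" for x y
    by (simp add: power2_eq_square algebra_simps)
qed

lemma not_degenerates_a_c3: "\<not> degenerates scale e (alg_a scale e \<delta>) (alg_c3 scale e)"
  using a_form_identity[of \<delta> "alg_c3 scale e" 2 1 3]
  by (auto simp: alg_c3_def bilinear_extension_basis coordinate_basis)

lemma degenerates_a_a_imp_eq:
  assumes "degenerates scale e (alg_a scale e \<delta>) (alg_a scale e \<delta>')"
  shows "\<delta> = \<delta>'"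
  \<comment> \<open>At \<open>i = 2\<close>, \<open>j = 3\<close>, \<open>k = 1\<close> the left
    side is \<open>\<delta>'\<close> and the squared difference is 1.\<close>
  using a_form_identity[OF assms, of 2 1 3]
  by (simp add: alg_a_def bilinear_extension_basis coordinate_basis coordinate_scale)

lemma degenerates_a_l1_imp:
  assumes "degenerates scale e (alg_a scale e \<delta>) (alg_l1 scale e)"
  shows "\<delta> = inverse 4"
proof -
  \<comment> \<open>The mixed products 1 and -1 contribute 1 on the left and the squared difference
    4 on the right.\<close>
  have "4 * \<delta> = 1"
    using a_form_identity[OF assms, of 2 1 3]
    by (simp add: alg_l1_def bilinear_extension_basis coordinate_basis coordinate_minus
        power2_eq_square mult.commute)
  then show ?thesis by (metis inverse_unique)
qed

end

section \<open>Case analysis over all pairs from the list\<close>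

theorem mainTheorem1:
  fixes s :: "'a::alg_closed_field \<Rightarrow> 'v::ab_group_add \<Rightarrow> 'v"
    and e :: "3 \<Rightarrow> 'v"
    and \<gg> \<hh> :: "'v \<Rightarrow> 'v \<Rightarrow> 'v"
  assumes "based_space s e"
    and "CHAR('a) \<noteq> 2"
    and "\<gg> \<in> algebra_list s e" and "\<hh> \<in> algebra_list s e" and "\<gg> \<noteq> \<hh>"
  shows "degenerates s e \<gg> \<hh> \<longleftrightarrow>
    (\<gg>, \<hh>) \<in>
      {(alg_c5 s e, alg_c3 s e), (alg_c5 s e, alg_c1 s e), (alg_c5 s e, alg_a0 s e)}
      \<union> {(alg_c3 s e, alg_c1 s e), (alg_c3 s e, alg_a0 s e)}
      \<union> (\<Union>\<delta>. {(alg_a s e \<delta>, alg_c1 s e), (alg_a s e \<delta>, alg_a0 s e)})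
      \<union> {(alg_a s e \<delta>, alg_l1 s e) |\<delta>. \<delta> = inverse (4 * 1)}
      \<union> {(alg_c1 s e, alg_a0 s e), (alg_l1 s e, alg_a0 s e)}"
    (is "_ \<longleftrightarrow> (\<gg>, \<hh>) \<in> ?R")
proof
  interpret based_space s e by fact
  have inf: "infinite (UNIV :: 'a set)"
    by (rule infinite_UNIV_alg_closed)
  have two: "(2 :: 'a) \<noteq> 0"
  proof
    assume "(2 :: 'a) = 0"
    then have "CHAR('a) dvd 2"
      using of_nat_eq_0_iff_char_dvd[of 2, where 'a = 'a] by simp
    then have "CHAR('a) = 1 \<or> CHAR('a) = 2"
      using two_is_prime_nat by (metis prime_nat_iff)
    with assms(2) show False by simp
  qed
  have alg: "algebra_structure s \<gg>"
    using algebra_list_nilpotent_associative(1)[OF assms(3)] .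
  have g: "\<gg> = alg_a0 s e \<or> \<gg> = alg_c1 s e \<or> \<gg> = alg_c3 s e \<or> \<gg> = alg_l1 s e \<or> \<gg> = alg_c5 s e
      \<or> (\<exists>\<delta>. \<gg> = alg_a s e \<delta>)"
    and h: "\<hh> = alg_a0 s e \<or> \<hh> = alg_c1 s e \<or> \<hh> = alg_c3 s e \<or> \<hh> = alg_l1 s e \<or> \<hh> = alg_c5 s e
      \<or> (\<exists>\<delta>. \<hh> = alg_a s e \<delta>)"
    using assms(3,4) by (auto simp: algebra_list_def)
  {
    assume deg: "degenerates s e \<gg> \<hh>"
    note not_comm = not_degenerates_commutative[OF _ alg] two
    note not_alt = not_degenerates_alternating[OF _ alg]
    note not_c5 = not_degenerates_c5[OF _ alg]
    from g show "(\<gg>, \<hh>) \<in> ?R"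
    proof (elim disjE exE)
      assume "\<gg> = alg_a0 s e"
      with h deg assms(5) not_comm not_alt show ?thesis by blast
    next
      assume "\<gg> = alg_c1 s e"
      with h deg assms(5) not_comm not_c5 not_degenerates_c1_c3 show ?thesis by blast
    next
      assume "\<gg> = alg_c3 s e"
      with h deg assms(5) not_comm not_c5 show ?thesis by blast
    next
      assume "\<gg> = alg_l1 s e"
      with h deg assms(5) not_alt show ?thesis by blast
    next
      assume "\<gg> = alg_c5 s e"
      with h deg assms(5) not_comm show ?thesis by blast
    next
      fix \<delta> assume eq: "\<gg> = alg_a s e \<delta>"
      from h show ?thesis
      proof (elim disjE exE)
        assume "\<hh> = alg_l1 s e"
        moreover from this have "\<delta> = inverse (4 * 1)"
          using eq deg degenerates_a_l1_imp[of \<delta>] by (simp only: mult_1_right)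
        ultimately show ?thesis using eq by blast
      next
        fix \<delta>' assume "\<hh> = alg_a s e \<delta>'"
        with eq deg assms(5) degenerates_a_a_imp_eq[of \<delta> \<delta>'] show ?thesis by simp
      \<comment> \<open>The zero algebra and \<open>alg_c1\<close> are listed targets;
        \<open>alg_c3\<close> is excluded by the form relation and \<open>alg_c5\<close> by triple
        products.\<close>
      qed (use eq deg not_c5 not_degenerates_a_c3 in blast)+
    qed
  next
    assume "(\<gg>, \<hh>) \<in> ?R"
    \<comment> \<open>Algebraic closedness supplies the square root of -1 that diagonalises the
      hyperbolic plane.\<close>
    obtain \<iota> :: 'a where "\<iota>\<^sup>2 = - 1"
      using nth_root_exists[of 2 "- 1"] by auto
    then have "\<iota> * \<iota> = - 1" by (simp add: power2_eq_square)
    then have "degenerates s e (alg_c5 s e) (alg_c3 s e)"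
      by (rule degenerates_c5_c3[OF inf two])
    moreover have "degenerates s e (alg_a s e (inverse (4 * 1))) (alg_l1 s e)"
      by (rule degenerates_a_l1[OF inf two]) (simp only: mult_1_right)
    ultimately show "degenerates s e \<gg> \<hh>"
      using \<open>(\<gg>, \<hh>) \<in> ?R\<close> degenerates_a0[OF inf alg] degenerates_c3_c1[OF inf]
        degenerates_c5_c1[OF inf] degenerates_a_c1[OF inf] by blast
  }
qed

end
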